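(* Let $\mathfrak S\subset\mathfrak P(X)$ be an interval system, $\mu:\mathfrak S\to\mathbb R$ a locally bounded measure, and $f:X\to\mathbb R^*$ a function. (a) The Lebesgue-Riesz integral $\int^{(LR)}\mu f$, if it exists, is unique. (b) Suppose $\mu\ge0$. Then the lower and upper Lebesgue-Darboux integrals (which exist in all circumstances) satisfy $$\int^{(LD-)}\mu f\le\int^{(LD+)}\mu f .$$ (c) Suppose $\mu\geq0$. If $f$ is Lebesgue-Riesz integrable then it is Lebesgue-Darboux integrable and $$\int^{(LD)}\mu f=\int^{(LR)}\mu f .$$
   Context: "Countable" includes finite. Interval system: a family $\mathfrak S\subset\mathfrak P(X)$ such that for all $A,B\in\mathfrak S$ each of $A\setminus B$ and $A\cap B$ is the union of a countable family of pairwise disjoint elements of $\mathfrak S$. Measure: $\mu:\mathfrak S\to\mathbb R$ such that $\mu(A)=\sum_\lambda\mu(A_\lambda)$, with absolute convergence, whenever $A\in\mathfrak S$ is a countable disjoint union of $A_\lambda\in\mathfrak S$. It is locally bounded if for each $A\in\mathfrak S$ the set of all sums $\sum_{j\in J}\mu(A_j)$ ($J$ finite, $A_j\in\mathfrak S$ pairwise disjoint, $A_j\subset A$) is bounded. For $a\in\mathbb R$, $|a|^+=\max(a,0)$, $|a|^-=\max(-a,0)$. Define the nonnegative measures $|\mu|^{\pm}(A)=\sup\sum_\lambda|\mu(A_\lambda)|^{\pm}$, the supremum over all countable disjoint decompositions $A=\bigcup_\lambda A_\lambda$ in $\mathfrak S$. Extended reals: $\mathbb R^*=\mathbb R\cup\{+\infty,-\infty,\pm\infty\}$,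 where $\pm\infty$ is a single symbol ("indefinite infinity"), with $|\pm\infty|^+=|\pm\infty|^-=+\infty$ and $(+\infty)-(+\infty)=\pm\infty$. Every countable family in $\mathbb R^*$ has a sum $\sum a_\lambda=\sum|a_\lambda|^+-\sum|a_\lambda|^-\in\mathbb R^*$. The relation $a\le b$ holds in the usual sense on $[-\infty,+\infty]$, and additionally $-\infty\le\pm\infty$, $\pm\infty\le\pm\infty$, $\pm\infty\le+\infty$. For a relation $\prec$: $a\prec'b$ means $a\prec b$ or $b=\pm\infty$; $a\,{}'\!\!\prec b$ means $a\prec b$ or $a=\pm\infty$. $\inf'$ denotes infimum in which the value $\pm\infty$ is counted as $+\infty$; $\sup'$ denotes supremum in which $\pm\infty$ is counted as $-\infty$. Formal sum over $\mathfrak S$: a countable indexed family $\mathsf C=\{(c_\lambda,C_\lambda)\}_{\lambda\in\Lambda}$ in $\mathbb R\times\mathfrak S$. Its value at $x\in X$ is $\mathsf C^\Sigma(x)=\sum_{\lambda:\,x\in C_\lambda}c_\lambda\in\mathbb R^*$. Put $\int^+\mu\,\mathsf C=\sum_\lambda\bigl(|c_\lambda|^+|\mu|^+(C_\lambda)+|c_\lambda|^-|\mu|^-(C_\lambda)\bigr)$, $\int^-\mu\,\mathsf C=\sum_\lambda\bigl(|c_\lambda|^-|\mu|^+(C_\lambda)+|c_\lambda|^+|\mu|^-(C_\lambda)\bigr)$ (both in $[0,+\infty]$), and $\int\mu\,\mathsf C=\int^+\mu\,\mathsf C-\int^-\mu\,\mathsf C\in\mathbb R^*$. Lebesgue-Riesz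 integral: if there is a formal sum $\mathsf D$ with $f(x)='\mathsf D^\Sigma(x)$ for all $x\in X$ and $\int\mu\,\mathsf D\ne\pm\infty$, then $\int\mu\,\mathsf D$ is a value of the Lebesgue-Riesz integral $\int^{(LR)}\mu f$, and $f$ is called Lebesgue-Riesz integrable. Lebesgue-Darboux integrals (for $\mu\ge0$): $\int^{(LD+)}\mu f=\inf'\{\int\mu\,\mathsf D: f(x)\le'\mathsf D^\Sigma(x)\ \forall x\in X\}\in[-\infty,+\infty]$ and $\int^{(LD-)}\mu f=\sup'\{\int\mu\,\mathsf C:\mathsf C^\Sigma(x)\,{}'\!\!\le f(x)\ \forall x\in X\}$, over formal sums. If the two agree, $f$ is Lebesgue-Darboux integrable and the common value is $\int^{(LD)}\mu f$. *)

theory Defs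
  imports "HOL-Analysis.Analysis"
begin

section \<open>The extended reals with an indefinite infinity\<close>

text \<open>\<open>Indef\<close> is the single symbol \<open>\<plusminus>\<infinity>\<close>, adjoined to \<open>[-\<infinity>, +\<infinity>]\<close>.\<close>

datatype rstar = Ext ereal | Indef

text \<open>\<open>|a|\<^sup>+ = max(a, 0)\<close> and \<open>|a|\<^sup>- = max(-a, 0)\<close>, where \<^const>\<open>e2ennreal\<close> truncates at 0.\<close>

fun pos_part :: "rstar \<Rightarrow> ennreal" where
  "pos_part (Ext a) = e2ennreal a"
| "pos_part Indef = top"

fun neg_part :: "rstar \<Rightarrow> ennreal" where
  "neg_part (Ext a) = e2ennreal (- a)"
| "neg_part Indef = top"

text \<open>The difference of two elements of \<open>[0, +\<infinity>]\<close>, with \<open>(+\<infinity>) - (+\<infinity>) = \<plusminus>\<infinity>\<close>.\<close>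

definition rdiff :: "ennreal \<Rightarrow> ennreal \<Rightarrow> rstar" where
  "rdiff a b = (if a = top \<and> b = top then Indef else Ext (enn2ereal a - enn2ereal b))"

definition rsum :: "('i \<Rightarrow> rstar) \<Rightarrow> 'i set \<Rightarrow> rstar" where
  "rsum a \<Lambda> = rdiff (\<Sum>\<^sub>\<infinity>i\<in>\<Lambda>. pos_part (a i)) (\<Sum>\<^sub>\<infinity>i\<in>\<Lambda>. neg_part (a i))"

instantiation rstar :: order
begin

fun less_eq_rstar :: "rstar \<Rightarrow> rstar \<Rightarrow> bool" where
  "Ext a \<le> Ext b \<longleftrightarrow> a \<le> b"
| "Ext a \<le> Indef \<longleftrightarrow> a = -\<infinity>"
| "Indef \<le> Ext b \<longleftrightarrow> b = \<infinity>"
| "Indef \<le> Indef \<longleftrightarrow> True"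

definition less_rstar :: "rstar \<Rightarrow> rstar \<Rightarrow> bool" where
  "a < b \<longleftrightarrow> a \<le> b \<and> \<not> b \<le> (a :: rstar)"

instance
proof
  fix a b c :: rstar
  show "a < b \<longleftrightarrow> a \<le> b \<and> \<not> b \<le> a" by (rule less_rstar_def)
  show "a \<le> a" by (cases a) auto
  show "a \<le> c" if "a \<le> b" "b \<le> c" using that by (cases a; cases b; cases c) auto
  show "a = b" if "a \<le> b" "b \<le> a" using that by (cases a; cases b) auto
qed

end

text \<open>The relations \<open>a \<prec>' b\<close> and \<open>a '\<prec> b\<close> derived from a relation \<open>\<prec>\<close>.\<close>

definition rprime :: "(rstar \<Rightarrow> rstar \<Rightarrow> bool) \<Rightarrow> rstar \<Rightarrow> rstar \<Rightarrow> bool" where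
  "rprime R a b \<longleftrightarrow> R a b \<or> b = Indef"

definition lprime :: "(rstar \<Rightarrow> rstar \<Rightarrow> bool) \<Rightarrow> rstar \<Rightarrow> rstar \<Rightarrow> bool" where
  "lprime R a b \<longleftrightarrow> R a b \<or> a = Indef"

text \<open>The readings of an element of \<^typ>\<open>rstar\<close> used by \<open>inf'\<close> and \<open>sup'\<close>.\<close>

fun indef_top :: "rstar \<Rightarrow> ereal" where
  "indef_top (Ext a) = a"
| "indef_top Indef = \<infinity>"

fun indef_bot :: "rstar \<Rightarrow> ereal" where
  "indef_bot (Ext a) = a"
| "indef_bot Indef = -\<infinity>"

definition inf' :: "rstar set \<Rightarrow> ereal" where
  "inf' V = Inf (indef_top ` V)"

definition sup' :: "rstar set \<Rightarrow> ereal" where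
  "sup' V = Sup (indef_bot ` V)"


section \<open>Interval systems and measures\<close>

text \<open>
  Countable families are indexed by arbitrary sets of natural numbers, finite and empty sets
  included; all notions below are invariant under reindexing.
\<close>

definition decomposition :: "'a set set \<Rightarrow> nat set \<Rightarrow> (nat \<Rightarrow> 'a set) \<Rightarrow> 'a set \<Rightarrow> bool" where
  "decomposition S \<Lambda> P A \<longleftrightarrow>
     (\<forall>i\<in>\<Lambda>. P i \<in> S) \<and> disjoint_family_on P \<Lambda> \<and> A = (\<Union>i\<in>\<Lambda>. P i)"

definition interval_system :: "'a set \<Rightarrow> 'a set set \<Rightarrow> bool" where
  "interval_system X S \<longleftrightarrow>
     S \<subseteq> Pow X \<and>
     (\<forall>A\<in>S. \<forall>B\<in>S. (\<exists>\<Lambda> P. decomposition S \<Lambda> P (A - B)) \<and> (\<exists>\<Lambda> P. decomposition S \<Lambda> P (A \<inter> B)))"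

definition real_measure :: "'a set set \<Rightarrow> ('a set \<Rightarrow> real) \<Rightarrow> bool" where
  "real_measure S \<mu> \<longleftrightarrow>
     (\<forall>A\<in>S. \<forall>\<Lambda> P. decomposition S \<Lambda> P A \<longrightarrow>
        (\<lambda>i. \<bar>\<mu> (P i)\<bar>) summable_on \<Lambda> \<and> ((\<lambda>i. \<mu> (P i)) has_sum \<mu> A) \<Lambda>)"

definition locally_bounded :: "'a set set \<Rightarrow> ('a set \<Rightarrow> real) \<Rightarrow> bool" where
  "locally_bounded S \<mu> \<longleftrightarrow>
     (\<forall>A\<in>S. bounded {\<Sum>j\<in>J. \<mu> (P j) | (J :: nat set) P.
        finite J \<and> (\<forall>j\<in>J. P j \<in> S \<and> P j \<subseteq> A) \<and> disjoint_family_on P J})"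

text \<open>\<open>|\<mu>|\<^sup>+\<close> and \<open>|\<mu>|\<^sup>-\<close>, with values in \<open>[0, +\<infinity>]\<close>; they are finite on \<open>S\<close> if \<open>\<mu>\<close> is locally bounded.\<close>

definition pos_variation :: "'a set set \<Rightarrow> ('a set \<Rightarrow> real) \<Rightarrow> 'a set \<Rightarrow> ennreal" where
  "pos_variation S \<mu> A =
     Sup {\<Sum>\<^sub>\<infinity>i\<in>\<Lambda>. ennreal (max (\<mu> (P i)) 0) | \<Lambda> P. decomposition S \<Lambda> P A}"

definition neg_variation :: "'a set set \<Rightarrow> ('a set \<Rightarrow> real) \<Rightarrow> 'a set \<Rightarrow> ennreal" where
  "neg_variation S \<mu> A =
     Sup {\<Sum>\<^sub>\<infinity>i\<in>\<Lambda>. ennreal (max (- \<mu> (P i)) 0) | \<Lambda> P. decomposition S \<Lambda> P A}"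


section \<open>Formal sums\<close>

datatype 'a formal_sum =
  Formal_Sum (index: "nat set") (coeff: "nat \<Rightarrow> real") (base: "nat \<Rightarrow> 'a set")

definition formal_sum_over :: "'a set set \<Rightarrow> 'a formal_sum \<Rightarrow> bool" where
  "formal_sum_over S C \<longleftrightarrow> (\<forall>i\<in>index C. base C i \<in> S)"

definition sum_value :: "'a formal_sum \<Rightarrow> 'a \<Rightarrow> rstar" where
  "sum_value C x = rsum (\<lambda>i. Ext (ereal (coeff C i))) {i \<in> index C. x \<in> base C i}"

definition pos_integral :: "'a set set \<Rightarrow> ('a set \<Rightarrow> real) \<Rightarrow> 'a formal_sum \<Rightarrow> ennreal" where
  "pos_integral S \<mu> C = (\<Sum>\<^sub>\<infinity>i\<in>index C.
      ennreal (max (coeff C i) 0) * pos_variation S \<mu> (base C i)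
    + ennreal (max (- coeff C i) 0) * neg_variation S \<mu> (base C i))"

definition neg_integral :: "'a set set \<Rightarrow> ('a set \<Rightarrow> real) \<Rightarrow> 'a formal_sum \<Rightarrow> ennreal" where
  "neg_integral S \<mu> C = (\<Sum>\<^sub>\<infinity>i\<in>index C.
      ennreal (max (- coeff C i) 0) * pos_variation S \<mu> (base C i)
    + ennreal (max (coeff C i) 0) * neg_variation S \<mu> (base C i))"

definition formal_integral :: "'a set set \<Rightarrow> ('a set \<Rightarrow> real) \<Rightarrow> 'a formal_sum \<Rightarrow> rstar" where
  "formal_integral S \<mu> C = rdiff (pos_integral S \<mu> C) (neg_integral S \<mu> C)"


section \<open>The integrals\<close>

text \<open>
  Equating the integral of \<open>D\<close> with \<open>Ext v\<close> includes the requirement that it differs from \<open>\<plusminus>\<infinity>\<close>;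
  the values \<open>+\<infinity>\<close> and \<open>-\<infinity>\<close> are allowed.
\<close>

definition has_LR_integral ::
  "'a set \<Rightarrow> 'a set set \<Rightarrow> ('a set \<Rightarrow> real) \<Rightarrow> ('a \<Rightarrow> rstar) \<Rightarrow> ereal \<Rightarrow> bool" where
  "has_LR_integral X S \<mu> f v \<longleftrightarrow>
     (\<exists>D. formal_sum_over S D \<and> (\<forall>x\<in>X. rprime (=) (f x) (sum_value D x))
        \<and> formal_integral S \<mu> D = Ext v)"

definition LR_integrable ::
  "'a set \<Rightarrow> 'a set set \<Rightarrow> ('a set \<Rightarrow> real) \<Rightarrow> ('a \<Rightarrow> rstar) \<Rightarrow> bool" where
  "LR_integrable X S \<mu> f \<longleftrightarrow> (\<exists>v. has_LR_integral X S \<mu> f v)"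

definition LR_integral ::
  "'a set \<Rightarrow> 'a set set \<Rightarrow> ('a set \<Rightarrow> real) \<Rightarrow> ('a \<Rightarrow> rstar) \<Rightarrow> ereal" where
  "LR_integral X S \<mu> f = (THE v. has_LR_integral X S \<mu> f v)"

definition LD_upper ::
  "'a set \<Rightarrow> 'a set set \<Rightarrow> ('a set \<Rightarrow> real) \<Rightarrow> ('a \<Rightarrow> rstar) \<Rightarrow> ereal" where
  "LD_upper X S \<mu> f = inf' {formal_integral S \<mu> D | D.
     formal_sum_over S D \<and> (\<forall>x\<in>X. rprime (\<le>) (f x) (sum_value D x))}"

definition LD_lower ::
  "'a set \<Rightarrow> 'a set set \<Rightarrow> ('a set \<Rightarrow> real) \<Rightarrow> ('a \<Rightarrow> rstar) \<Rightarrow> ereal" where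
  "LD_lower X S \<mu> f = sup' {formal_integral S \<mu> C | C.
     formal_sum_over S C \<and> (\<forall>x\<in>X. lprime (\<le>) (sum_value C x) (f x))}"

definition LD_integrable ::
  "'a set \<Rightarrow> 'a set set \<Rightarrow> ('a set \<Rightarrow> real) \<Rightarrow> ('a \<Rightarrow> rstar) \<Rightarrow> bool" where
  "LD_integrable X S \<mu> f \<longleftrightarrow> LD_lower X S \<mu> f = LD_upper X S \<mu> f"

text \<open>Only meaningful if \<^const>\<open>LD_integrable\<close> holds, when it is the common value of the two.\<close>

definition LD_integral ::
  "'a set \<Rightarrow> 'a set set \<Rightarrow> ('a set \<Rightarrow> real) \<Rightarrow> ('a \<Rightarrow> rstar) \<Rightarrow> ereal" where
  "LD_integral X S \<mu> f = LD_upper X S \<mu> f"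

end

theory Submission
  imports Defs
begin

text \<open>
  Each of \<open>|\<mu>|\<^sup>+\<close>, \<open>|\<mu>|\<^sup>-\<close> extends to a measure on a \<open>\<sigma>\<close>-algebra containing \<open>S\<close>, so that
  \<open>\<integral>\<^sup>+\<mu>C\<close> and \<open>\<integral>\<^sup>-\<mu>C\<close> become Lebesgue integrals of the functions \<open>p\<close> and \<open>n\<close> that sum the
  positive and the negative coefficients at a point. If one of these integrals is finite, then
  \<open>p = n = \<infinity>\<close> only on a null set, and elsewhere a comparison of \<open>p - n\<close> with \<open>p' - n'\<close> can be
  written without subtraction, as one of \<open>p + n'\<close> with \<open>p' + n\<close>, and integrated.

  For the extension, \<open>|\<mu>|\<^sup>+(A)\<close> is the supremum of the sums of \<open>\<mu>\<^sup>+\<close> over finite disjoint families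
  in \<open>S\<close> inside \<open>A\<close>. In this form it is monotone and superadditive on arbitrary sets; only
  countable subadditivity uses the measure property. The outer measure
  \<open>E \<mapsto> inf {|\<mu>|\<^sup>+(A) | A \<supseteq> E}\<close>, with \<open>A\<close> ranging over the countable disjoint unions of members
  of \<open>S\<close>, then satisfies Caratheodory's criterion at each member of \<open>S\<close> at once.
\<close>

section \<open>Countable disjoint unions\<close>

lemma sum_le_infsum_ennreal:
  fixes f :: "'i \<Rightarrow> ennreal"
  assumes "finite F" "F \<subseteq> A"
  shows "sum f F \<le> infsum f A"
proof -
  have "infsum f A = (SUP F\<in>{F. finite F \<and> F \<subseteq> A}. sum f F)"
    by (rule nonneg_infsum_complete) simp
  then show ?thesis using assms by (auto intro: SUP_upper)
qed

lemma SUP_add_SUP_le_ennreal: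
  fixes f g :: "'i \<Rightarrow> ennreal"
  assumes "I \<noteq> {}" "J \<noteq> {}" "\<And>i j. i \<in> I \<Longrightarrow> j \<in> J \<Longrightarrow> f i + g j \<le> c"
  shows "(SUP i\<in>I. f i) + (SUP j\<in>J. g j) \<le> c"
proof -
  have "f i + (SUP j\<in>J. g j) \<le> c" if "i \<in> I" for i
    unfolding ennreal_SUP_add_right[OF assms(2)] using assms(3) that by (intro SUP_least)
  then show ?thesis
    unfolding ennreal_SUP_add_left[OF assms(1), symmetric] by (intro SUP_least)
qed

text \<open>Families are taken as sets of sets: in an indexed disjoint family only the empty set can
  recur, so passing to the range loses nothing.\<close>

definition sigma_disjoint :: "'a set set \<Rightarrow> 'a set set" where
  "sigma_disjoint S = {\<Union>\<P> | \<P>. countable \<P> \<and> \<P> \<subseteq> S \<and> disjoint \<P>}"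

lemma sigma_disjoint_iff:
  "A \<in> sigma_disjoint S \<longleftrightarrow> (\<exists>\<P>. countable \<P> \<and> \<P> \<subseteq> S \<and> disjoint \<P> \<and> A = \<Union>\<P>)"
  unfolding sigma_disjoint_def by blast

lemma sigma_disjointE:
  assumes "A \<in> sigma_disjoint S"
  obtains \<P> where "countable \<P>" "\<P> \<subseteq> S" "disjoint \<P>" "A = \<Union>\<P>"
  using assms by (auto simp: sigma_disjoint_def)

lemma sigma_disjoint_base: "A \<in> S \<Longrightarrow> A \<in> sigma_disjoint S"
  by (auto simp: sigma_disjoint_def intro!: exI[of _ "{A}"])

lemma sigma_disjoint_empty: "{} \<in> sigma_disjoint S"
  by (auto simp: sigma_disjoint_def intro!: exI[of _ "{}"])

lemma decomposition_sigma_disjoint: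
  assumes "decomposition S \<Lambda> P A"
  shows "A \<in> sigma_disjoint S"
  unfolding sigma_disjoint_def
  using assms
  by (auto simp: decomposition_def intro!: exI[of _ "P ` \<Lambda>"] disjoint_family_on_disjoint_image)

lemma disjoint_imp_decomposition:
  assumes "countable \<P>" "\<P> \<subseteq> S" "disjoint \<P>"
  obtains \<Lambda> P where "decomposition S \<Lambda> P (\<Union>\<P>)" "bij_betw P \<Lambda> \<P>"
proof -
  define P where "P = inv_into \<P> (to_nat_on \<P>)"
  have inj: "inj_on (to_nat_on \<P>) \<P>"
    using assms(1) by (rule inj_on_to_nat_on)
  have bij: "bij_betw P (to_nat_on \<P> ` \<P>) \<P>"
    unfolding P_def by (intro bij_betw_inv_into inj_on_imp_bij_betw inj)
  have "disjoint_family_on P (to_nat_on \<P> ` \<P>)"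
    using bij assms(3) by (intro disjoint_image_disjoint_family_on) (auto simp: bij_betw_def)
  then have "decomposition S (to_nat_on \<P> ` \<P>) P (\<Union>\<P>)"
    using bij assms(2) unfolding decomposition_def bij_betw_def by auto
  then show thesis using bij that by blast
qed

lemma sigma_disjoint_Union_disjoint:
  assumes "countable I" "disjoint_family_on A I" and A: "\<And>i. i \<in> I \<Longrightarrow> A i \<in> sigma_disjoint S"
  shows "(\<Union>i\<in>I. A i) \<in> sigma_disjoint S"
proof -
  have "\<forall>i\<in>I. \<exists>\<P>. countable \<P> \<and> \<P> \<subseteq> S \<and> disjoint \<P> \<and> A i = \<Union>\<P>"
    using A unfolding sigma_disjoint_iff by blast
  then obtain Q where Q: "\<And>i. i \<in> I \<Longrightarrow> countable (Q i)" "\<And>i. i \<in> I \<Longrightarrow> Q i \<subseteq> S"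
      "\<And>i. i \<in> I \<Longrightarrow> disjoint (Q i)" "\<And>i. i \<in> I \<Longrightarrow> A i = \<Union>(Q i)"
    by metis
  have "disjoint (\<Union>i\<in>I. Q i)"
  proof (rule disjointI)
    fix B C assume "B \<in> (\<Union>i\<in>I. Q i)" "C \<in> (\<Union>i\<in>I. Q i)" and ne: "B \<noteq> C"
    then obtain i j where ij: "i \<in> I" "j \<in> I" "B \<in> Q i" "C \<in> Q j" by blast
    show "B \<inter> C = {}"
    proof (cases "i = j")
      case True
      then show ?thesis using Q(3) ij ne by (meson disjointD)
    next
      case False
      then have "A i \<inter> A j = {}" using assms(2) ij by (auto simp: disjoint_family_on_def)
      then show ?thesis using Q(4) ij by blast
    qed
  qed
  moreover have "countable (\<Union>i\<in>I. Q i)" using assms(1) Q(1) by blast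
  moreover have "(\<Union>i\<in>I. A i) = \<Union>(\<Union>i\<in>I. Q i)" using Q(4) by auto
  moreover have "(\<Union>i\<in>I. Q i) \<subseteq> S" using Q(2) by blast
  ultimately show ?thesis unfolding sigma_disjoint_def by blast
qed

lemma real_measure_uminus:
  assumes "real_measure S \<mu>"
  shows "real_measure S (\<lambda>A. - \<mu> A)"
  using assms by (simp add: real_measure_def has_sum_uminus)

locale interval_measure =
  fixes X :: "'a set" and S :: "'a set set" and \<mu> :: "'a set \<Rightarrow> real"
  assumes interval_system: "interval_system X S" and real_measure: "real_measure S \<mu>"
begin

lemma base_subset: "A \<in> S \<Longrightarrow> A \<subseteq> X"
  using interval_system by (auto simp: interval_system_def)

lemma Diff_base: "A \<in> S \<Longrightarrow> B \<in> S \<Longrightarrow> A - B \<in> sigma_disjoint S"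
  and Int_base: "A \<in> S \<Longrightarrow> B \<in> S \<Longrightarrow> A \<inter> B \<in> sigma_disjoint S"
  using interval_system unfolding interval_system_def by (meson decomposition_sigma_disjoint)+

section \<open>Closure properties of countable disjoint unions\<close>

text \<open>Removing a single member of \<open>S\<close> acts on each piece of \<open>A\<close>
  separately, where \<open>Diff_base\<close> applies.\<close>

lemma Diff_sigma_disjoint:
  assumes "A \<in> sigma_disjoint S" "B \<in> S"
  shows "A - B \<in> sigma_disjoint S"
proof -
  obtain \<P> where P: "countable \<P>" "\<P> \<subseteq> S" "disjoint \<P>" "A = \<Union>\<P>"
    using assms(1) by (rule sigma_disjointE)
  have "(\<Union>C\<in>\<P>. C - B) \<in> sigma_disjoint S"
    using P assms(2)
    by (intro sigma_disjoint_Union_disjoint Diff_base)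
       (auto simp: disjoint_family_on_def disjoint_def)
  moreover have "(\<Union>C\<in>\<P>. C - B) = A - B" using P(4) by auto
  ultimately show ?thesis by simp
qed

lemma Diff_finite_Union:
  assumes "A \<in> sigma_disjoint S" "finite F" "F \<subseteq> S"
  shows "A - \<Union>F \<in> sigma_disjoint S"
  using assms(2,3)
proof (induction F rule: finite_induct)
  case empty
  then show ?case using assms(1) by simp
next
  case (insert B F)
  have "A - \<Union>(insert B F) = (A - \<Union>F) - B" by auto
  then show ?case using Diff_sigma_disjoint insert by auto
qed

lemma Int_sigma_disjoint:
  assumes "A \<in> sigma_disjoint S" "B \<in> sigma_disjoint S"
  shows "A \<inter> B \<in> sigma_disjoint S"
proof -
  \<comment> \<open>Distributes an intersection over the pieces of its first factor. It is used
    twice: with \<open>B\<close> as first factor against one member of \<open>S\<close>, then with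
    \<open>A\<close> as first factor against \<open>B\<close>.\<close>
  have *: "A' \<inter> B' \<in> sigma_disjoint S"
    if "A' \<in> sigma_disjoint S" "\<And>C. C \<in> S \<Longrightarrow> C \<inter> B' \<in> sigma_disjoint S" for A' B'
  proof -
    note A' = that
    obtain \<P> where P: "countable \<P>" "\<P> \<subseteq> S" "disjoint \<P>" "A' = \<Union>\<P>"
      using sigma_disjointE[OF A'(1)] by blast
    have "(\<Union>C\<in>\<P>. C \<inter> B') \<in> sigma_disjoint S"
      using P A'(2)
      by (intro sigma_disjoint_Union_disjoint) (auto simp: disjoint_family_on_def disjoint_def)
    moreover have "(\<Union>C\<in>\<P>. C \<inter> B') = A' \<inter> B'" using P(4) by auto
    ultimately show ?thesis by simp
  qed
  have "C \<inter> B \<in> sigma_disjoint S" if "C \<in> S" for C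
    using *[OF assms(2), of C] Int_base that by (simp add: Int_commute)
  then show ?thesis using * assms(1) by blast
qed

text \<open>Along an enumeration, each disjointed set removes only finitely many members of
  \<open>S\<close>, so it remains a countable disjoint union.\<close>

lemma Union_base:
  assumes "countable \<A>" "\<A> \<subseteq> S"
  shows "\<Union>\<A> \<in> sigma_disjoint S"
proof (cases "\<A> = {}")
  case True
  then show ?thesis by (simp add: sigma_disjoint_empty)
next
  case False
  define A where "A = from_nat_into \<A>"
  have A: "range A = \<A>" unfolding A_def using False assms(1) by (rule range_from_nat_into)
  have "disjointed A n \<in> sigma_disjoint S" for n
    unfolding disjointed_def
    using A assms(2) by (intro Diff_finite_Union sigma_disjoint_base) auto
  then have "(\<Union>n. disjointed A n) \<in> sigma_disjoint S"
    by (intro sigma_disjoint_Union_disjoint disjoint_family_disjointed) auto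
  then show ?thesis unfolding UN_disjointed_eq A .
qed

lemma Union_sigma_disjoint:
  assumes "\<And>i :: nat. A i \<in> sigma_disjoint S"
  shows "(\<Union>i. A i) \<in> sigma_disjoint S"
proof -
  have "\<forall>i. \<exists>\<P>. countable \<P> \<and> \<P> \<subseteq> S \<and> A i = \<Union>\<P>"
    using assms unfolding sigma_disjoint_iff by meson
  then obtain Q where Q: "\<And>i. countable (Q i)" "\<And>i. Q i \<subseteq> S" "\<And>i. A i = \<Union>(Q i)" by metis
  have "\<Union>(\<Union>i. Q i) \<in> sigma_disjoint S" using Q by (intro Union_base) auto
  moreover have "(\<Union>i. A i) = \<Union>(\<Union>i. Q i)" unfolding Q(3) by blast
  ultimately show ?thesis by simp
qed

section \<open>First consequences of countable additivity\<close>

text \<open>The empty index set decomposes the empty set, so its measure is an empty sum.\<close>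

lemma measure_empty:
  assumes "{} \<in> S"
  shows "\<mu> {} = 0"
proof -
  have "decomposition S {} (\<lambda>_. {}) {}" by (simp add: decomposition_def disjoint_family_on_def)
  then have "((\<lambda>_. \<mu> {}) has_sum \<mu> {}) ({} :: nat set)"
    using real_measure assms unfolding real_measure_def by blast
  then show ?thesis using has_sum_unique[OF _ has_sum_empty] by blast
qed

text \<open>The function \<open>ennreal\<close> truncates at 0, so the right side sums positive
  parts. Truncation only increases the finite partial sums, whose limit is \<mu>(A) by countable
  additivity.\<close>

lemma measure_le_infsum:
  assumes "A \<in> S" "countable \<P>" "\<P> \<subseteq> S" "disjoint \<P>" "A = \<Union>\<P>"
  shows "ennreal (\<mu> A) \<le> (\<Sum>\<^sub>\<infinity>B\<in>\<P>. ennreal (\<mu> B))"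
proof -
  obtain \<Lambda> P where P: "decomposition S \<Lambda> P A" and bij: "bij_betw P \<Lambda> \<P>"
    using disjoint_imp_decomposition assms by metis
  have "((\<lambda>i. \<mu> (P i)) has_sum \<mu> A) \<Lambda>"
    using real_measure P assms(1) by (auto simp: real_measure_def)
  then have lim: "(sum (\<lambda>i. \<mu> (P i)) \<longlongrightarrow> \<mu> A) (finite_subsets_at_top \<Lambda>)"
    by (simp add: has_sum_def)
  have "ennreal (\<mu> A) \<le> (\<Sum>\<^sub>\<infinity>i\<in>\<Lambda>. ennreal (\<mu> (P i)))"
  proof (rule tendsto_upperbound[OF tendsto_ennrealI[OF lim]])
    show "\<forall>\<^sub>F F in finite_subsets_at_top \<Lambda>.
        ennreal (\<Sum>i\<in>F. \<mu> (P i)) \<le> (\<Sum>\<^sub>\<infinity>i\<in>\<Lambda>. ennreal (\<mu> (P i)))"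
    proof (intro eventually_finite_subsets_at_top_weakI)
      fix F assume F: "finite F" "F \<subseteq> \<Lambda>"
      have "ennreal (\<Sum>i\<in>F. \<mu> (P i)) \<le> ennreal (\<Sum>i\<in>F. max 0 (\<mu> (P i)))"
        by (intro ennreal_leI sum_mono) simp
      also have "\<dots> = (\<Sum>i\<in>F. ennreal (\<mu> (P i)))"
        by (subst sum_ennreal[symmetric]) (auto simp: ennreal_max_0)
      also have "\<dots> \<le> (\<Sum>\<^sub>\<infinity>i\<in>\<Lambda>. ennreal (\<mu> (P i)))"
        using F by (intro sum_le_infsum_ennreal) auto
      finally show "ennreal (\<Sum>i\<in>F. \<mu> (P i)) \<le> (\<Sum>\<^sub>\<infinity>i\<in>\<Lambda>. ennreal (\<mu> (P i)))" .
    qed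
  qed simp
  also have "\<dots> = (\<Sum>\<^sub>\<infinity>B\<in>\<P>. ennreal (\<mu> B))"
    using bij by (rule infsum_reindex_bij_betw)
  finally show ?thesis .
qed

section \<open>The positive variation as a measure\<close>

definition finite_variation :: "'a set \<Rightarrow> ennreal" where
  "finite_variation A = (SUP F\<in>{F. finite F \<and> F \<subseteq> S \<and> disjoint F \<and> \<Union>F \<subseteq> A}. \<Sum>B\<in>F. ennreal (\<mu> B))"

lemma sum_le_finite_variation:
  assumes "finite F" "F \<subseteq> S" "disjoint F" "\<Union>F \<subseteq> A"
  shows "(\<Sum>B\<in>F. ennreal (\<mu> B)) \<le> finite_variation A"
  unfolding finite_variation_def by (rule SUP_upper) (use assms in auto)

lemma finite_variation_leI:
  assumes "\<And>F. finite F \<Longrightarrow> F \<subseteq> S \<Longrightarrow> disjoint F \<Longrightarrow> \<Union>F \<subseteq> A \<Longrightarrow> (\<Sum>B\<in>F. ennreal (\<mu> B)) \<le> c"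
  shows "finite_variation A \<le> c"
  unfolding finite_variation_def by (rule SUP_least) (use assms in auto)

lemma finite_variation_mono: "A \<subseteq> B \<Longrightarrow> finite_variation A \<le> finite_variation B"
  by (rule finite_variation_leI, rule sum_le_finite_variation) auto

lemma finite_variation_empty: "finite_variation {} = 0"
proof -
  have "(\<Sum>B\<in>F. ennreal (\<mu> B)) \<le> 0" if "F \<subseteq> S" "\<Union>F \<subseteq> {}" for F
    using that measure_empty by (subst sum.neutral) (auto, metis ennreal_0 subsetD)
  then have "finite_variation {} \<le> 0" by (intro finite_variation_leI)
  then show ?thesis by simp
qed

lemma finite_variation_superadditive:
  assumes "A \<inter> B = {}"
  shows "finite_variation A + finite_variation B \<le> finite_variation (A \<union> B)"
proof -
  let ?\<F> = "\<lambda>A. {F. finite F \<and> F \<subseteq> S \<and> disjoint F \<and> \<Union>F \<subseteq> A}"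
  have ne: "?\<F> A \<noteq> {}" for A by (auto intro!: exI[of _ "{}"])
  have le: "(\<Sum>C\<in>F. ennreal (\<mu> C)) + (\<Sum>C\<in>G. ennreal (\<mu> C)) \<le> finite_variation (A \<union> B)"
    if F: "F \<in> ?\<F> A" and G: "G \<in> ?\<F> B" for F G
  proof -
    \<comment> \<open>The two families can share only the empty set, which contributes 0, so their
      sums add up to the sum over the union.\<close>
    have FG: "F \<inter> G \<subseteq> {{}}" using F G assms by blast
    have "(\<Sum>C\<in>F. ennreal (\<mu> C)) + (\<Sum>C\<in>G. ennreal (\<mu> C)) = (\<Sum>C\<in>F \<union> G. ennreal (\<mu> C))"
    proof (rule sum.union_inter_neutral[symmetric])
      show "\<forall>C\<in>F \<inter> G. ennreal (\<mu> C) = 0" using FG F measure_empty by fastforce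
    qed (use F G in auto)
    also have "\<dots> \<le> finite_variation (A \<union> B)"
    proof (rule sum_le_finite_variation)
      show "disjoint (F \<union> G)" using F G assms by (intro disjoint_union) blast+
    qed (use F G in auto)
    finally show ?thesis .
  qed
  show ?thesis
    unfolding finite_variation_def[of A] finite_variation_def[of B]
    by (rule SUP_add_SUP_le_ennreal[OF ne ne le])
qed

lemma sum_finite_variation_le:
  assumes "finite I" "disjoint_family_on A I"
  shows "(\<Sum>i\<in>I. finite_variation (A i)) \<le> finite_variation (\<Union>i\<in>I. A i)"
  using assms
proof (induction I rule: finite_induct)
  case (insert i I)
  then have "A i \<inter> (\<Union>j\<in>I. A j) = {}" by (auto simp: disjoint_family_on_def)
  moreover have "(\<Sum>j\<in>I. finite_variation (A j)) \<le> finite_variation (\<Union>j\<in>I. A j)"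
    using insert by (auto simp: disjoint_family_on_def)
  ultimately show ?case
    using insert finite_variation_superadditive[of "A i" "\<Union>j\<in>I. A j"]
    by (auto intro: order_trans[OF add_left_mono])
qed simp

text \<open>Partial sums over a decomposition are sums over finite disjoint families. Conversely,
  what a finite family leaves of \<open>A\<close> is again a countable disjoint union, so the family
  can be completed to a decomposition of \<open>A\<close>.\<close>

lemma finite_variation_eq_pos_variation:
  assumes "A \<in> sigma_disjoint S"
  shows "pos_variation S \<mu> A = finite_variation A"
proof (rule antisym)
  show "pos_variation S \<mu> A \<le> finite_variation A"
    unfolding pos_variation_def
  proof (rule Sup_least, clarify)
    fix \<Lambda> P assume P: "decomposition S \<Lambda> P A"
    show "(\<Sum>\<^sub>\<infinity>i\<in>\<Lambda>. ennreal (max (\<mu> (P i)) 0)) \<le> finite_variation A"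
    proof (rule infsum_le_finite_sums[OF nonneg_summable_on_complete])
      fix F assume F: "finite F" "F \<subseteq> \<Lambda>"
      have "(\<Sum>i\<in>F. ennreal (max (\<mu> (P i)) 0)) = (\<Sum>i\<in>F. ennreal (\<mu> (P i)))"
        by (intro sum.cong) (auto simp: max_def ennreal_neg)
      also have "\<dots> = (\<Sum>B\<in>P ` F. ennreal (\<mu> B))"
      \<comment> \<open>Distinct indices may carry the same set only if it is empty, so the
        repetition adds 0.\<close>
      proof (subst sum.reindex_nontrivial)
        fix i j assume ij: "i \<in> F" "j \<in> F" "i \<noteq> j" "P i = P j"
        then have "P i \<inter> P j = {}"
          using P F by (intro disjoint_family_onD[of P \<Lambda>]) (auto simp: decomposition_def)
        moreover have "P i \<in> S" using P F ij by (auto simp: decomposition_def)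
        ultimately show "ennreal (\<mu> (P i)) = 0" using ij measure_empty by auto
      qed (use F in auto)
      also have "\<dots> \<le> finite_variation A"
      proof (rule sum_le_finite_variation)
        show "disjoint (P ` F)"
          using P F disjoint_family_on_mono
          by (intro disjoint_family_on_disjoint_image) (auto simp: decomposition_def)
      qed (use P F in \<open>auto simp: decomposition_def\<close>)
      finally show "(\<Sum>i\<in>F. ennreal (max (\<mu> (P i)) 0)) \<le> finite_variation A" .
    qed simp
  qed
next
  show "finite_variation A \<le> pos_variation S \<mu> A"
  proof (rule finite_variation_leI)
    fix F assume F: "finite F" "F \<subseteq> S" "disjoint F" "\<Union>F \<subseteq> A"
    obtain \<Q> where Q: "countable \<Q>" "\<Q> \<subseteq> S" "disjoint \<Q>" "A - \<Union>F = \<Union>\<Q>"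
      using Diff_finite_Union[OF assms F(1,2)] by (rule sigma_disjointE)
    have "disjoint (F \<union> \<Q>)" using F Q by (intro disjoint_union) auto
    moreover have "countable (F \<union> \<Q>)" using F Q by (simp add: countable_finite)
    moreover have "F \<union> \<Q> \<subseteq> S" using F Q by auto
    moreover have "\<Union>(F \<union> \<Q>) = A" using F Q by auto
    ultimately obtain \<Lambda> P where P: "decomposition S \<Lambda> P A" and bij: "bij_betw P \<Lambda> (F \<union> \<Q>)"
      using disjoint_imp_decomposition by metis
    have "(\<Sum>B\<in>F. ennreal (\<mu> B)) \<le> (\<Sum>\<^sub>\<infinity>B\<in>F \<union> \<Q>. ennreal (\<mu> B))"
      using F by (intro sum_le_infsum_ennreal) auto
    also have "\<dots> = (\<Sum>\<^sub>\<infinity>i\<in>\<Lambda>. ennreal (\<mu> (P i)))"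
      by (rule infsum_reindex_bij_betw[OF bij, symmetric])
    also have "\<dots> = (\<Sum>\<^sub>\<infinity>i\<in>\<Lambda>. ennreal (max (\<mu> (P i)) 0))"
      by (intro infsum_cong) (auto simp: max_def ennreal_neg)
    also have "\<dots> \<le> pos_variation S \<mu> A"
      unfolding pos_variation_def using P by (intro Sup_upper) auto
    finally show "(\<Sum>B\<in>F. ennreal (\<mu> B)) \<le> pos_variation S \<mu> A" .
  qed
qed

section \<open>Countable subadditivity\<close>

text \<open>Members of \<open>S\<close> that partition the sets \<open>B \<inter> A i\<close>
  together partition \<open>B\<close>, so countable additivity bounds \<mu>(B) by the sum of
  positive parts over all pieces. Grouping the pieces by \<open>i\<close> bounds each group by
  \<open>finite_variation (B \<inter> A i)\<close>.\<close>

lemma measure_le_suminf_finite_variation: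
  fixes A :: "nat \<Rightarrow> 'a set"
  assumes B: "B \<in> S" "B \<subseteq> (\<Union>i. A i)" and A: "disjoint_family A" "\<And>i. A i \<in> sigma_disjoint S"
  shows "ennreal (\<mu> B) \<le> (\<Sum>i. finite_variation (B \<inter> A i))"
proof -
  have "\<forall>i. \<exists>\<P>. countable \<P> \<and> \<P> \<subseteq> S \<and> disjoint \<P> \<and> B \<inter> A i = \<Union>\<P>"
    using Int_sigma_disjoint[OF sigma_disjoint_base[OF B(1)] A(2)]
    unfolding sigma_disjoint_iff by blast
  then obtain Q where Q: "\<And>i. countable (Q i)" "\<And>i. Q i \<subseteq> S" "\<And>i. disjoint (Q i)"
      "\<And>i. B \<inter> A i = \<Union>(Q i)"
    by metis
  have "disjoint (\<Union>i. Q i)"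
  proof (rule disjointI)
    fix C D assume "C \<in> (\<Union>i. Q i)" "D \<in> (\<Union>i. Q i)" and ne: "C \<noteq> D"
    then obtain i j where ij: "C \<in> Q i" "D \<in> Q j" by blast
    show "C \<inter> D = {}"
    proof (cases "i = j")
      case True
      then show ?thesis using Q(3) ij ne by (meson disjointD)
    next
      case False
      then have "A i \<inter> A j = {}" using A(1) by (auto simp: disjoint_family_on_def)
      then show ?thesis using Q(4)[of i] Q(4)[of j] ij by blast
    qed
  qed
  moreover have "B = (\<Union>i. B \<inter> A i)" using B(2) by blast
  then have "B = \<Union>(\<Union>i. Q i)" unfolding Q(4) by blast
  ultimately have "ennreal (\<mu> B) \<le> (\<Sum>\<^sub>\<infinity>C\<in>(\<Union>i. Q i). ennreal (\<mu> C))"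
    using Q B by (intro measure_le_infsum) auto
  also have "\<dots> \<le> (\<Sum>i. finite_variation (B \<inter> A i))"
  proof (rule infsum_le_finite_sums[OF nonneg_summable_on_complete])
    fix G assume G: "finite G" "G \<subseteq> (\<Union>i. Q i)"
    then have "\<forall>C\<in>G. \<exists>i. C \<in> Q i" by blast
    \<comment> \<open>The empty set may occur in several \<open>Q i\<close>; choosing one index per
      piece makes the groups disjoint.\<close>
    then obtain \<iota> where \<iota>: "\<And>C. C \<in> G \<Longrightarrow> C \<in> Q (\<iota> C)" by metis
    have "(\<Sum>C\<in>G. ennreal (\<mu> C)) = (\<Sum>i\<in>\<iota> ` G. \<Sum>C | C \<in> G \<and> \<iota> C = i. ennreal (\<mu> C))"
      using G(1) by (rule sum.image_gen)
    also have "\<dots> \<le> (\<Sum>i\<in>\<iota> ` G. finite_variation (B \<inter> A i))"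
    proof (intro sum_mono sum_le_finite_variation)
      fix i
      have sub: "{C \<in> G. \<iota> C = i} \<subseteq> Q i" using \<iota> by auto
      show "{C \<in> G. \<iota> C = i} \<subseteq> S" "\<Union>{C \<in> G. \<iota> C = i} \<subseteq> B \<inter> A i"
        using sub Q(2,4) by blast+
      show "disjoint {C \<in> G. \<iota> C = i}" using pairwise_subset[OF Q(3) sub] .
    qed (use G in auto)
    also have "\<dots> \<le> (\<Sum>i. finite_variation (B \<inter> A i))"
      using G by (intro sum_le_suminf) auto
    finally show "(\<Sum>C\<in>G. ennreal (\<mu> C)) \<le> (\<Sum>i. finite_variation (B \<inter> A i))" .
  qed simp
  finally show ?thesis .
qed

text \<open>Each member \<open>B\<close> of a finite family is estimated by its traces on the
  \<open>A i\<close>. After the sums are exchanged, superadditivity gathers the traces on a fixed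
  \<open>A i\<close> again.\<close>

lemma finite_variation_subadditive_disjoint:
  fixes A :: "nat \<Rightarrow> 'a set"
  assumes A: "disjoint_family A" "\<And>i. A i \<in> sigma_disjoint S"
  shows "finite_variation (\<Union>i. A i) \<le> (\<Sum>i. finite_variation (A i))"
proof (rule finite_variation_leI)
  fix F assume F: "finite F" "F \<subseteq> S" "disjoint F" "\<Union>F \<subseteq> (\<Union>i. A i)"
  have "(\<Sum>B\<in>F. ennreal (\<mu> B)) \<le> (\<Sum>B\<in>F. \<Sum>i. finite_variation (B \<inter> A i))"
    using F A by (intro sum_mono measure_le_suminf_finite_variation) auto
  also have "\<dots> = (\<Sum>i. \<Sum>B\<in>F. finite_variation (B \<inter> A i))"
    by (rule suminf_sum[symmetric]) simp
  also have "\<dots> \<le> (\<Sum>i. finite_variation (A i))"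
  proof (intro suminf_le)
    fix i
    have "(\<Sum>B\<in>F. finite_variation (B \<inter> A i)) \<le> finite_variation (\<Union>B\<in>F. B \<inter> A i)"
      using F by (intro sum_finite_variation_le) (auto simp: disjoint_family_on_def disjoint_def)
    also have "\<dots> \<le> finite_variation (A i)" by (intro finite_variation_mono) auto
    finally show "(\<Sum>B\<in>F. finite_variation (B \<inter> A i)) \<le> finite_variation (A i)" .
  qed auto
  finally show "(\<Sum>B\<in>F. ennreal (\<mu> B)) \<le> (\<Sum>i. finite_variation (A i))" .
qed

lemma finite_variation_subadditive_base:
  fixes A :: "nat \<Rightarrow> 'a set"
  assumes "\<And>i. A i \<in> insert {} S"
  shows "finite_variation (\<Union>i. A i) \<le> (\<Sum>i. finite_variation (A i))"
proof -
  have "disjointed A n \<in> sigma_disjoint S" for n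
  proof -
    \<comment> \<open>Empty sets, which may lie outside \<open>S\<close>, are dropped so that the
      subtrahend is a finite union of members of \<open>S\<close>.\<close>
    have "disjointed A n = A n - \<Union>((A ` {0..<n}) - {{}})"
      unfolding disjointed_def by auto
    moreover have "A n \<in> sigma_disjoint S"
      using assms[of n] by (auto simp: sigma_disjoint_base sigma_disjoint_empty)
    moreover have "A ` {0..<n} - {{}} \<subseteq> S" using assms by auto
    ultimately show ?thesis by (simp add: Diff_finite_Union)
  qed
  then have "finite_variation (\<Union>n. disjointed A n) \<le> (\<Sum>n. finite_variation (disjointed A n))"
    by (intro finite_variation_subadditive_disjoint disjoint_family_disjointed)
  also have "\<dots> \<le> (\<Sum>n. finite_variation (A n))"
    by (intro suminf_le finite_variation_mono disjointed_subset) auto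
  finally show ?thesis by (simp add: UN_disjointed_eq)
qed

lemma sigma_disjoint_sequence:
  assumes "A \<in> sigma_disjoint S"
  obtains C :: "nat \<Rightarrow> 'a set" where "\<And>k. C k \<in> insert {} S" "disjoint_family C" "A = (\<Union>k. C k)"
proof -
  obtain \<P> where P: "countable \<P>" "\<P> \<subseteq> S" "disjoint \<P>" "A = \<Union>\<P>"
    using assms by (rule sigma_disjointE)
  obtain \<Lambda> P where P: "decomposition S \<Lambda> P A"
    using disjoint_imp_decomposition[OF P(1-3)] P(4) by metis
  show thesis
  proof (rule that[of "\<lambda>k. if k \<in> \<Lambda> then P k else {}"])
    show "disjoint_family (\<lambda>k. if k \<in> \<Lambda> then P k else {})"
      using P by (auto simp: decomposition_def disjoint_family_on_def)
    show "A = (\<Union>k. if k \<in> \<Lambda> then P k else {})"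
      using P by (auto simp: decomposition_def split: if_splits)
  qed (use P in \<open>auto simp: decomposition_def\<close>)
qed

text \<open>A difference of two countable disjoint unions need not be of the same kind, so the
  sets \<open>A i\<close> are first split into members of \<open>S\<close>, which can be made disjoint.\<close>

lemma finite_variation_subadditive:
  fixes A :: "nat \<Rightarrow> 'a set"
  assumes "\<And>i. A i \<in> sigma_disjoint S"
  shows "finite_variation (\<Union>i. A i) \<le> (\<Sum>i. finite_variation (A i))"
proof -
  have "\<exists>C :: nat \<Rightarrow> 'a set. (\<forall>k. C k \<in> insert {} S) \<and> disjoint_family C \<and> A i = (\<Union>k. C k)" for i
    using sigma_disjoint_sequence[OF assms[of i]] by metis
  then obtain C :: "nat \<Rightarrow> nat \<Rightarrow> 'a set" where C: "\<And>i k. C i k \<in> insert {} S"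
      "\<And>i. disjoint_family (C i)" "\<And>i. A i = (\<Union>k. C i k)"
    by metis
  have "(\<Union>i. A i) = (\<Union>n. case_prod C (prod_decode n))"
    unfolding C(3) by (auto simp: split_def) (metis fst_conv prod_encode_inverse snd_conv)
  also have "finite_variation \<dots> \<le> (\<Sum>n. finite_variation (case_prod C (prod_decode n)))"
    using C(1) by (intro finite_variation_subadditive_base) (auto simp: split_def)
  also have "\<dots> = (\<Sum>i. \<Sum>k. finite_variation (C i k))"
    using suminf_ennreal_2dimen[of "\<lambda>i. \<Sum>k. finite_variation (C i k)"
        "\<lambda>(i, k). finite_variation (C i k)"]
    by (simp add: split_def comp_def)
  \<comment> \<open>For fixed \<open>i\<close> the pieces are disjoint subsets of
    \<open>A i\<close>, so superadditivity bounds every partial sum.\<close>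
  also have "\<dots> \<le> (\<Sum>i. finite_variation (A i))"
  proof (intro suminf_le suminf_le_const)
    fix i n
    have "(\<Sum>k<n. finite_variation (C i k)) \<le> finite_variation (\<Union>k<n. C i k)"
      using C(2) by (intro sum_finite_variation_le) (auto simp: disjoint_family_on_def)
    also have "\<dots> \<le> finite_variation (A i)"
      unfolding C(3) by (intro finite_variation_mono) auto
    finally show "(\<Sum>k<n. finite_variation (C i k)) \<le> finite_variation (A i)" .
  qed auto
  finally show ?thesis .
qed

section \<open>Caratheodory extension of the positive variation\<close>

text \<open>A set without a cover of this kind gets the infimum of the empty set, which is
  \<infinity>.\<close>

definition outer_variation :: "'a set \<Rightarrow> ennreal" where
  "outer_variation E = (INF A\<in>{A \<in> sigma_disjoint S. E \<subseteq> A}. finite_variation A)"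

lemma outer_variation_le: "A \<in> sigma_disjoint S \<Longrightarrow> E \<subseteq> A \<Longrightarrow> outer_variation E \<le> finite_variation A"
  unfolding outer_variation_def by (intro INF_lower) auto

lemma outer_variation_mono: "E \<subseteq> E' \<Longrightarrow> outer_variation E \<le> outer_variation E'"
  unfolding outer_variation_def by (intro INF_superset_mono) auto

lemma outer_variation_eq: "A \<in> sigma_disjoint S \<Longrightarrow> outer_variation A = finite_variation A"
  by (intro antisym outer_variation_le)
     (auto simp: outer_variation_def intro!: INF_greatest finite_variation_mono)

lemma outer_variation_empty: "outer_variation {} = 0"
  by (simp add: outer_variation_eq sigma_disjoint_empty finite_variation_empty)

lemma outer_variation_subadditive:
  fixes E :: "nat \<Rightarrow> 'a set"
  shows "outer_variation (\<Union>i. E i) \<le> (\<Sum>i. outer_variation (E i))"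
proof (rule ennreal_le_epsilon)
  fix e :: real assume e: "0 < e" "(\<Sum>i. outer_variation (E i)) < top"
  \<comment> \<open>The errors e/2, e/4, ... add up to e. Finiteness of the total makes each outer
    variation finite, so that adding an error increases it strictly and a cover within that error
    exists.\<close>
  have "\<exists>A \<in> sigma_disjoint S. E i \<subseteq> A \<and> finite_variation A \<le> outer_variation (E i) + e * (1/2) ^ Suc i" for i
  proof -
    have "outer_variation (E i) < outer_variation (E i) + e * (1/2) ^ Suc i"
      using e by (auto simp add: less_top dest!: ennreal_suminf_lessD)
    then show ?thesis
      unfolding outer_variation_def[of "E i"] INF_less_iff by (auto intro: less_imp_le)
  qed
  then obtain A where A: "\<And>i. A i \<in> sigma_disjoint S" "\<And>i. E i \<subseteq> A i"
      "\<And>i. finite_variation (A i) \<le> outer_variation (E i) + e * (1/2) ^ Suc i"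
    by metis
  have "outer_variation (\<Union>i. E i) \<le> finite_variation (\<Union>i. A i)"
    using A by (intro outer_variation_le Union_sigma_disjoint) auto
  also have "\<dots> \<le> (\<Sum>i. finite_variation (A i))"
    using A by (intro finite_variation_subadditive)
  also have "\<dots> \<le> (\<Sum>i. outer_variation (E i) + e * (1/2) ^ Suc i)"
    using A by (intro suminf_le) auto
  also have "\<dots> = (\<Sum>i. outer_variation (E i)) + (\<Sum>i. ennreal e * ennreal ((1/2) ^ Suc i))"
    using e by (subst suminf_add[symmetric])
      (auto simp del: ennreal_suminf_cmult simp add: ennreal_mult[symmetric])
  also have "\<dots> = (\<Sum>i. outer_variation (E i)) + e"
    unfolding ennreal_suminf_cmult
    by (subst suminf_ennreal_eq[OF zero_le_power power_half_series]) auto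
  finally show "outer_variation (\<Union>i. E i) \<le> (\<Sum>i. outer_variation (E i)) + e" .
qed

text \<open>A cover \<open>A\<close> of \<open>E\<close> is cut into covers
  \<open>A \<inter> B\<close> and \<open>A - B\<close> of the two parts, both countable disjoint
  unions because \<open>B\<close> is in \<open>S\<close>. Superadditivity gives one inequality,
  subadditivity the other.\<close>

lemma outer_variation_split:
  assumes "B \<in> S"
  shows "outer_variation (E \<inter> B) + outer_variation (E - B) = outer_variation E"
proof (rule antisym)
  show "outer_variation (E \<inter> B) + outer_variation (E - B) \<le> outer_variation E"
    unfolding outer_variation_def[of E]
  proof (rule INF_greatest, clarify)
    fix A assume A: "A \<in> sigma_disjoint S" "E \<subseteq> A"
    have "outer_variation (E \<inter> B) + outer_variation (E - B)
        \<le> finite_variation (A \<inter> B) + finite_variation (A - B)"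
      using A assms
      by (intro add_mono outer_variation_le Int_sigma_disjoint Diff_sigma_disjoint)
         (auto intro: sigma_disjoint_base)
    also have "\<dots> \<le> finite_variation (A \<inter> B \<union> (A - B))"
      by (intro finite_variation_superadditive) auto
    also have "A \<inter> B \<union> (A - B) = A" by auto
    finally show "outer_variation (E \<inter> B) + outer_variation (E - B) \<le> finite_variation A" .
  qed
next
  let ?E = "\<lambda>i :: nat. if i = 0 then E \<inter> B else if i = 1 then E - B else {}"
  have "E = (\<Union>i. ?E i)" by (auto split: if_splits)
  then have "outer_variation E \<le> (\<Sum>i. outer_variation (?E i))"
    using outer_variation_subadditive[of ?E] by simp
  also have "\<dots> = (\<Sum>i\<in>{0, 1}. outer_variation (?E i))"
    by (intro suminf_finite) (auto simp: outer_variation_empty)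
  finally show "outer_variation E \<le> outer_variation (E \<inter> B) + outer_variation (E - B)" by simp
qed

text \<open>Caratheodory's construction on all subsets of \<open>X\<close>: the measurable sets are
  those that split every subset additively, and \<open>outer_variation_split\<close> puts
  \<open>S\<close> among them.\<close>

lemma pos_variation_extends_to_measure:
  obtains M where "space M = X" "S \<subseteq> sets M" "\<And>A. A \<in> S \<Longrightarrow> emeasure M A = pos_variation S \<mu> A"
proof -
  interpret sigma_algebra X "Pow X" by (rule sigma_algebra_Pow)
  have "outer_measure_space (Pow X) outer_variation"
    by (auto simp: outer_measure_space_def positive_def increasing_def countably_subadditive_def
        outer_variation_empty outer_variation_mono outer_variation_subadditive)
  then have ms: "measure_space X (lambda_system X (Pow X) outer_variation) outer_variation"
    by (rule caratheodory_lemma)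
  let ?L = "lambda_system X (Pow X) outer_variation"
  define M where "M = measure_of X ?L outer_variation"
  have "sigma_algebra X ?L" using ms by (simp add: measure_space_def)
  then have sets: "sets M = ?L" and space: "space M = X"
    unfolding M_def by (auto simp: sigma_algebra.sets_measure_of_eq sigma_algebra.space_measure_of_eq)
  have S: "S \<subseteq> ?L"
    using base_subset by (auto simp: lambda_system_eq outer_variation_split)
  have "emeasure M A = pos_variation S \<mu> A" if "A \<in> S" for A
  proof -
    have "emeasure M A = outer_variation A"
      unfolding M_def using ms S that by (intro emeasure_measure_of_sigma) (auto simp: measure_space_def)
    then show ?thesis
      using that by (simp add: outer_variation_eq finite_variation_eq_pos_variation sigma_disjoint_base)
  qed
  with space sets S that show thesis by blast
qed

end

section \<open>Formal sums as integrands\<close>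

text \<open>Turns sums over index sets into series, for which measurability and termwise integration
  are available.\<close>

lemma infsum_eq_suminf_ennreal:
  fixes f :: "nat \<Rightarrow> ennreal"
  shows "(\<Sum>\<^sub>\<infinity>i\<in>I. f i) = (\<Sum>i. f i * indicator I i)"
proof -
  have "(\<Sum>\<^sub>\<infinity>i\<in>I. f i) = (\<Sum>\<^sub>\<infinity>i. f i * indicator I i)"
    by (intro infsum_cong_neutral) (auto simp: indicator_def)
  also have "\<dots> = (\<Sum>i. f i * indicator I i)"
    by (intro sums_unique has_sum_imp_sums has_sum_infsum nonneg_summable_on_complete) simp
  finally show ?thesis .
qed

lemma infsum_add_ennreal:
  fixes f g :: "nat \<Rightarrow> ennreal"
  shows "(\<Sum>\<^sub>\<infinity>i\<in>I. f i + g i) = (\<Sum>\<^sub>\<infinity>i\<in>I. f i) + (\<Sum>\<^sub>\<infinity>i\<in>I. g i)"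
  by (simp add: infsum_eq_suminf_ennreal distrib_right suminf_add)

text \<open>Negative weights count as 0. With the coefficients of a formal sum as weights this is
  the function p of the overview, with their negatives it is n.\<close>

definition weighted_sum :: "nat set \<Rightarrow> (nat \<Rightarrow> real) \<Rightarrow> (nat \<Rightarrow> 'a set) \<Rightarrow> 'a \<Rightarrow> ennreal" where
  "weighted_sum I c B x = (\<Sum>\<^sub>\<infinity>i\<in>{i \<in> I. x \<in> B i}. ennreal (c i))"

lemma weighted_sum_eq_suminf:
  "weighted_sum I c B = (\<lambda>x. \<Sum>i. ennreal (c i) * indicator I i * indicator (B i) x)"
  by (rule ext) (auto simp: weighted_sum_def infsum_eq_suminf_ennreal indicator_def intro!: suminf_cong)

lemma weighted_summand_measurable:
  assumes "\<And>i. i \<in> I \<Longrightarrow> B i \<in> sets M"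
  shows "(\<lambda>x. ennreal (c i) * indicator I i * indicator (B i) x) \<in> borel_measurable M"
  using assms by (cases "i \<in> I") auto

lemma borel_measurable_weighted_sum:
  assumes "\<And>i. i \<in> I \<Longrightarrow> B i \<in> sets M"
  shows "weighted_sum I c B \<in> borel_measurable M"
  unfolding weighted_sum_eq_suminf
  by (intro borel_measurable_suminf_order weighted_summand_measurable assms)

lemma nn_integral_weighted_sum:
  assumes "\<And>i. i \<in> I \<Longrightarrow> B i \<in> sets M"
  shows "(\<integral>\<^sup>+x. weighted_sum I c B x \<partial>M) = (\<Sum>\<^sub>\<infinity>i\<in>I. ennreal (c i) * emeasure M (B i))"
proof -
  have "(\<integral>\<^sup>+x. weighted_sum I c B x \<partial>M)
      = (\<Sum>i. \<integral>\<^sup>+x. ennreal (c i) * indicator I i * indicator (B i) x \<partial>M)"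
    unfolding weighted_sum_eq_suminf
    by (intro nn_integral_suminf weighted_summand_measurable assms)
  also have "\<dots> = (\<Sum>i. ennreal (c i) * emeasure M (B i) * indicator I i)"
    using assms by (intro suminf_cong) (auto simp: indicator_def[of I] nn_integral_cmult_indicator)
  finally show ?thesis by (simp add: infsum_eq_suminf_ennreal)
qed

lemma ennreal_max_zero: "ennreal (max x 0) = ennreal x"
  by (auto simp: max_def ennreal_neg)

lemma sum_value_eq_rdiff:
  "sum_value C x = rdiff (weighted_sum (index C) (coeff C) (base C) x)
     (weighted_sum (index C) (\<lambda>i. - coeff C i) (base C) x)"
  by (simp add: sum_value_def rsum_def weighted_sum_def)

section \<open>Comparison without subtraction\<close>

text \<open>The negative parts are moved across the inequality. The alternatives with
  \<open>top\<close> are those where a difference is \<open>Indef\<close> and carries no information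
  about its parts.\<close>

lemma rdiff_le_imp:
  assumes "rdiff p n \<le> rdiff p' n'"
  shows "p + n' \<le> p' + n \<or> p = top \<and> n = top \<or> p' = top \<and> n' = top"
  using assms
  by (cases p; cases n; cases p'; cases n')
     (auto simp: rdiff_def top_ereal_def ennreal_plus[symmetric] simp del: ennreal_plus)

text \<open>The way back from the additive form: as neither difference is \<open>Indef\<close>, an
  infinite term fixes the value of its difference and finite terms cancel.\<close>

lemma rdiff_Ext_le:
  assumes "rdiff p n = Ext v" "rdiff p' n' = Ext w" "p + n' \<le> p' + n"
  shows "v \<le> w"
  using assms
  by (cases p; cases n; cases p'; cases n')
     (auto simp: rdiff_def top_ereal_def ennreal_plus[symmetric] top_unique simp del: ennreal_plus split: if_splits)

lemma rdiff_Ext_finite: "rdiff p n = Ext v \<Longrightarrow> p < top \<or> n < top"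
  by (auto simp: rdiff_def less_top split: if_splits)

text \<open>A finite integral forces its integrand to be finite almost everywhere, so each
  indefinite alternative in \<open>le\<close> holds only on a null set.\<close>

lemma nn_integral_difference_le:
  assumes [measurable]: "p \<in> borel_measurable M" "n \<in> borel_measurable M"
      "p' \<in> borel_measurable M" "n' \<in> borel_measurable M"
    and fin: "(\<integral>\<^sup>+x. p x \<partial>M) < top \<or> (\<integral>\<^sup>+x. n x \<partial>M) < top"
    and fin': "(\<integral>\<^sup>+x. p' x \<partial>M) < top \<or> (\<integral>\<^sup>+x. n' x \<partial>M) < top"
    and le: "\<And>x. x \<in> space M \<Longrightarrow> p x + n' x \<le> p' x + n x \<or> p x = top \<and> n x = top \<or> p' x = top \<and> n' x = top"
  shows "(\<integral>\<^sup>+x. p x \<partial>M) + (\<integral>\<^sup>+x. n' x \<partial>M) \<le> (\<integral>\<^sup>+x. p' x \<partial>M) + (\<integral>\<^sup>+x. n x \<partial>M)"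
proof -
  have AE: "AE x in M. q x \<noteq> top" if "q \<in> borel_measurable M" "(\<integral>\<^sup>+x. q x \<partial>M) < top" for q
    using nn_integral_PInf_AE[of q M] that by (auto simp: less_top)
  have 1: "AE x in M. \<not> (p x = top \<and> n x = top)" using fin AE[of p] AE[of n] by auto
  have 2: "AE x in M. \<not> (p' x = top \<and> n' x = top)" using fin' AE[of p'] AE[of n'] by auto
  have "AE x in M. p x + n' x \<le> p' x + n x" using 1 2 AE_space by eventually_elim (use le in blast)
  then have "(\<integral>\<^sup>+x. p x + n' x \<partial>M) \<le> (\<integral>\<^sup>+x. p' x + n x \<partial>M)" by (rule nn_integral_mono_AE)
  then show ?thesis by (simp add: nn_integral_add)
qed

section \<open>Integrals against a single variation\<close>

text \<open>Lets the extension theorem for the positive variation, applied to -\<mu>, serve the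
  negative variation as well.\<close>

lemma neg_variation_eq_pos_variation: "neg_variation S \<mu> = pos_variation S (\<lambda>A. - \<mu> A)"
  by (simp add: fun_eq_iff neg_variation_def pos_variation_def)

text \<open>The integral of the positive parts of the weights against \<open>|\<mu>|\<^sup>+\<close>
  alone. The sign choices for \<mu> and for the weights give the four summands of the positive and
  negative integrals of a formal sum.\<close>

definition part_integral ::
  "'a set set \<Rightarrow> ('a set \<Rightarrow> real) \<Rightarrow> nat set \<Rightarrow> (nat \<Rightarrow> real) \<Rightarrow> (nat \<Rightarrow> 'a set) \<Rightarrow> ennreal" where
  "part_integral S \<mu> I c B = (\<Sum>\<^sub>\<infinity>i\<in>I. ennreal (c i) * pos_variation S \<mu> (B i))"

lemma pos_integral_eq_part_integral:
  "pos_integral S \<mu> C = part_integral S \<mu> (index C) (coeff C) (base C)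
    + part_integral S (\<lambda>A. - \<mu> A) (index C) (\<lambda>i. - coeff C i) (base C)"
  by (simp add: pos_integral_def part_integral_def neg_variation_eq_pos_variation
      infsum_add_ennreal ennreal_max_zero)

lemma neg_integral_eq_part_integral:
  "neg_integral S \<mu> C = part_integral S \<mu> (index C) (\<lambda>i. - coeff C i) (base C)
    + part_integral S (\<lambda>A. - \<mu> A) (index C) (coeff C) (base C)"
  by (simp add: neg_integral_def part_integral_def neg_variation_eq_pos_variation
      infsum_add_ennreal ennreal_max_zero)

context interval_measure
begin

text \<open>On the extended measure the part integrals are Lebesgue integrals of weighted sums, so
  the pointwise comparison integrates by \<open>nn_integral_difference_le\<close>.\<close>

lemma part_integral_le:
  assumes "formal_sum_over S C" "formal_sum_over S D"
    and "part_integral S \<mu> (index C) (coeff C) (base C) < top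
      \<or> part_integral S \<mu> (index C) (\<lambda>i. - coeff C i) (base C) < top"
    and "part_integral S \<mu> (index D) (coeff D) (base D) < top
      \<or> part_integral S \<mu> (index D) (\<lambda>i. - coeff D i) (base D) < top"
    and le: "\<And>x. x \<in> X \<Longrightarrow> sum_value C x \<le> sum_value D x \<or> sum_value C x = Indef \<or> sum_value D x = Indef"
  shows "part_integral S \<mu> (index C) (coeff C) (base C) + part_integral S \<mu> (index D) (\<lambda>i. - coeff D i) (base D)
    \<le> part_integral S \<mu> (index D) (coeff D) (base D) + part_integral S \<mu> (index C) (\<lambda>i. - coeff C i) (base C)"
proof -
  obtain M where M: "space M = X" "S \<subseteq> sets M" "\<And>A. A \<in> S \<Longrightarrow> emeasure M A = pos_variation S \<mu> A"
    using pos_variation_extends_to_measure by metis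
  have sets: "base E i \<in> sets M" if "formal_sum_over S E" "i \<in> index E" for E i
    using that M(2) by (auto simp: formal_sum_over_def)
  have int: "part_integral S \<mu> (index E) c (base E) = (\<integral>\<^sup>+x. weighted_sum (index E) c (base E) x \<partial>M)"
    if "formal_sum_over S E" for E c
    using that M(3) sets[OF that]
    by (auto simp: part_integral_def nn_integral_weighted_sum formal_sum_over_def intro!: infsum_cong)
  have Indef: "rdiff a b = Indef \<longleftrightarrow> a = top \<and> b = top" for a b by (auto simp: rdiff_def)
  show ?thesis
    using assms(3,4) unfolding int[OF assms(1)] int[OF assms(2)]
    by (intro nn_integral_difference_le borel_measurable_weighted_sum sets assms(1,2))
       (use le M(1) in \<open>auto simp: sum_value_eq_rdiff Indef dest!: rdiff_le_imp\<close>)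
qed

lemma part_integral_eq:
  assumes "formal_sum_over S C" "formal_sum_over S D"
    and "part_integral S \<mu> (index C) (coeff C) (base C) < top
      \<or> part_integral S \<mu> (index C) (\<lambda>i. - coeff C i) (base C) < top"
    and "part_integral S \<mu> (index D) (coeff D) (base D) < top
      \<or> part_integral S \<mu> (index D) (\<lambda>i. - coeff D i) (base D) < top"
    and eq: "\<And>x. x \<in> X \<Longrightarrow> sum_value C x = sum_value D x \<or> sum_value C x = Indef \<or> sum_value D x = Indef"
  shows "part_integral S \<mu> (index C) (coeff C) (base C) + part_integral S \<mu> (index D) (\<lambda>i. - coeff D i) (base D)
    = part_integral S \<mu> (index D) (coeff D) (base D) + part_integral S \<mu> (index C) (\<lambda>i. - coeff C i) (base C)"
  by (intro antisym part_integral_le assms) (use eq in force)+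

end


section \<open>Uniqueness and comparison of the integrals\<close>

lemma pos_variation_nonpos:
  assumes "\<And>A. A \<in> S \<Longrightarrow> \<mu> A \<le> 0"
  shows "pos_variation S \<mu> A = 0"
proof -
  have "(\<Sum>\<^sub>\<infinity>i\<in>\<Lambda>. ennreal (max (\<mu> (P i)) 0)) = 0" if "decomposition S \<Lambda> P A" for \<Lambda> P
    using that assms by (intro infsum_0) (auto simp: decomposition_def ennreal_max_zero ennreal_neg)
  then show ?thesis unfolding pos_variation_def by (intro antisym Sup_least) auto
qed

text \<open>For nonnegative \<mu> this is applied to -\<mu>: the negative variation drops out of
  both integrals of a formal sum.\<close>

lemma part_integral_nonpos:
  assumes "\<And>A. A \<in> S \<Longrightarrow> \<mu> A \<le> 0"
  shows "part_integral S \<mu> I c B = 0"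
  using pos_variation_nonpos[of S \<mu>] assms by (simp add: part_integral_def)

text \<open>Two witnesses agree wherever neither is \<open>Indef\<close>. They are compared for each
  variation separately, and the two resulting equations are added.\<close>

lemma (in interval_measure) has_LR_integral_unique:
  assumes "has_LR_integral X S \<mu> f v" "has_LR_integral X S \<mu> f w"
  shows "v = w"
proof -
  interpret minus: interval_measure X S "\<lambda>A. - \<mu> A"
    using interval_system real_measure by unfold_locales (auto intro: real_measure_uminus)
  obtain C where C: "formal_sum_over S C" "\<And>x. x \<in> X \<Longrightarrow> rprime (=) (f x) (sum_value C x)"
      "formal_integral S \<mu> C = Ext v"
    using assms(1) by (auto simp: has_LR_integral_def)
  obtain D where D: "formal_sum_over S D" "\<And>x. x \<in> X \<Longrightarrow> rprime (=) (f x) (sum_value D x)"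
      "formal_integral S \<mu> D = Ext w"
    using assms(2) by (auto simp: has_LR_integral_def)
  have eq: "sum_value C x = sum_value D x \<or> sum_value C x = Indef \<or> sum_value D x = Indef" if "x \<in> X" for x
    using C(2)[OF that] D(2)[OF that] by (auto simp: rprime_def)
  have fin: "pos_integral S \<mu> C < top \<or> neg_integral S \<mu> C < top"
    "pos_integral S \<mu> D < top \<or> neg_integral S \<mu> D < top"
    using rdiff_Ext_finite C(3) D(3) unfolding formal_integral_def by blast+
  \<comment> \<open>Both the positive and the negative integral contain one summand for each
    variation, so finiteness of either leaves a finite part for \<mu> and one for -\<mu>.\<close>
  then have fin:
    "part_integral S \<mu> (index C) (coeff C) (base C) < top
      \<or> part_integral S \<mu> (index C) (\<lambda>i. - coeff C i) (base C) < top"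
    "part_integral S (\<lambda>A. - \<mu> A) (index C) (coeff C) (base C) < top
      \<or> part_integral S (\<lambda>A. - \<mu> A) (index C) (\<lambda>i. - coeff C i) (base C) < top"
    "part_integral S \<mu> (index D) (coeff D) (base D) < top
      \<or> part_integral S \<mu> (index D) (\<lambda>i. - coeff D i) (base D) < top"
    "part_integral S (\<lambda>A. - \<mu> A) (index D) (coeff D) (base D) < top
      \<or> part_integral S (\<lambda>A. - \<mu> A) (index D) (\<lambda>i. - coeff D i) (base D) < top"
    unfolding pos_integral_eq_part_integral neg_integral_eq_part_integral
    by (auto simp: ennreal_add_less_top)
  \<comment> \<open>The equation for -\<mu> is reversed, because the positive integral pairs -\<mu>
    with the negated coefficients.\<close>
  have "pos_integral S \<mu> C + neg_integral S \<mu> D = pos_integral S \<mu> D + neg_integral S \<mu> C"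
    using arg_cong2[where f = "(+)", OF part_integral_eq[OF C(1) D(1) fin(1,3) eq]
        minus.part_integral_eq[OF C(1) D(1) fin(2,4) eq, symmetric]]
    unfolding pos_integral_eq_part_integral neg_integral_eq_part_integral
    by (simp only: ac_simps)
  then show ?thesis
    using C(3) D(3) unfolding formal_integral_def by (metis antisym order_refl rdiff_Ext_le)
qed

lemma (in interval_measure) LD_lower_le_upper:
  assumes nonneg: "\<And>A. A \<in> S \<Longrightarrow> 0 \<le> \<mu> A"
  shows "LD_lower X S \<mu> f \<le> LD_upper X S \<mu> f"
proof -
  have integrals: "pos_integral S \<mu> C = part_integral S \<mu> (index C) (coeff C) (base C)"
    "neg_integral S \<mu> C = part_integral S \<mu> (index C) (\<lambda>i. - coeff C i) (base C)" for C
    using nonneg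
    by (simp_all add: pos_integral_eq_part_integral neg_integral_eq_part_integral part_integral_nonpos)
  have "indef_bot (formal_integral S \<mu> C) \<le> indef_top (formal_integral S \<mu> D)"
    if C: "formal_sum_over S C" "\<forall>x\<in>X. lprime (\<le>) (sum_value C x) (f x)"
      and D: "formal_sum_over S D" "\<forall>x\<in>X. rprime (\<le>) (f x) (sum_value D x)" for C D
  proof (cases "formal_integral S \<mu> C"; cases "formal_integral S \<mu> D")
    \<comment> \<open>Only this case has content: an indefinite integral reads as
      \<open>-\<infinity>\<close> on the lower side and as \<infinity> on the upper side.\<close>
    fix v w assume vw: "formal_integral S \<mu> C = Ext v" "formal_integral S \<mu> D = Ext w"
    \<comment> \<open>Where neither sum is \<open>Indef\<close>, both inequalities with
      \<open>f x\<close> are genuine and compose, even if \<open>f x\<close> itself is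
      \<open>Indef\<close>.\<close>
    have le: "sum_value C x \<le> sum_value D x \<or> sum_value C x = Indef \<or> sum_value D x = Indef" if "x \<in> X" for x
      using C(2) D(2) that unfolding lprime_def rprime_def by (meson order_trans)
    note vw' = vw[unfolded formal_integral_def integrals]
    have "v \<le> w"
      using part_integral_le[OF C(1) D(1) rdiff_Ext_finite[OF vw'(1)] rdiff_Ext_finite[OF vw'(2)] le]
      by (rule rdiff_Ext_le[OF vw'])
    then show ?thesis using vw by simp
  qed simp_all
  then show ?thesis
    unfolding LD_lower_def LD_upper_def sup'_def inf'_def
    by (intro Sup_least Inf_greatest) blast
qed

theorem lemma16p5:
  fixes X :: "'a set" and S :: "'a set set" and \<mu> :: "'a set \<Rightarrow> real" and f :: "'a \<Rightarrow> rstar"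
  assumes "interval_system X S" and "real_measure S \<mu>" and "locally_bounded S \<mu>"
  shows "(\<forall>v w. has_LR_integral X S \<mu> f v \<longrightarrow> has_LR_integral X S \<mu> f w \<longrightarrow> v = w)
    \<and> ((\<forall>A\<in>S. 0 \<le> \<mu> A) \<longrightarrow> LD_lower X S \<mu> f \<le> LD_upper X S \<mu> f)
    \<and> ((\<forall>A\<in>S. 0 \<le> \<mu> A) \<longrightarrow> LR_integrable X S \<mu> f \<longrightarrow>
         LD_integrable X S \<mu> f \<and> LD_integral X S \<mu> f = LR_integral X S \<mu> f)"
proof -
  interpret interval_measure X S \<mu> using assms by unfold_locales
  have unique: "v = w" if "has_LR_integral X S \<mu> f v" "has_LR_integral X S \<mu> f w" for v w
    using that by (rule has_LR_integral_unique)
  have le: "LD_lower X S \<mu> f \<le> LD_upper X S \<mu> f" if "\<forall>A\<in>S. 0 \<le> \<mu> A"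
    using that by (intro LD_lower_le_upper) blast
  have "LD_integrable X S \<mu> f \<and> LD_integral X S \<mu> f = LR_integral X S \<mu> f"
    if nonneg: "\<forall>A\<in>S. 0 \<le> \<mu> A" and LR: "LR_integrable X S \<mu> f"
  proof -
    obtain v where v: "has_LR_integral X S \<mu> f v" using LR by (auto simp: LR_integrable_def)
    then obtain D where D: "formal_sum_over S D" "\<forall>x\<in>X. rprime (=) (f x) (sum_value D x)"
        "formal_integral S \<mu> D = Ext v"
      by (auto simp: has_LR_integral_def)
    \<comment> \<open>Equality gives both inequalities, so the same \<open>D\<close> competes for
      the infimum and for the supremum. Its integral \<open>v\<close> bounds the upper integral from
      above and the lower one from below, and \<open>le\<close> closes the chain.\<close>
    have D_bounds: "\<forall>x\<in>X. rprime (\<le>) (f x) (sum_value D x)"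
      "\<forall>x\<in>X. lprime (\<le>) (sum_value D x) (f x)"
      using D(2) by (auto simp: rprime_def lprime_def)
    have "LD_upper X S \<mu> f \<le> indef_top (formal_integral S \<mu> D)"
      unfolding LD_upper_def inf'_def using D(1) D_bounds(1) by (intro Inf_lower imageI) blast
    moreover have "indef_bot (formal_integral S \<mu> D) \<le> LD_lower X S \<mu> f"
      unfolding LD_lower_def sup'_def using D(1) D_bounds(2)
      by (intro Sup_upper imageI) blast
    ultimately have "LD_upper X S \<mu> f = v" "LD_lower X S \<mu> f = v"
      using le[OF nonneg] D(3) by auto
    moreover have "LR_integral X S \<mu> f = v"
      unfolding LR_integral_def using v unique by (intro the_equality)
    ultimately show ?thesis by (simp add: LD_integrable_def LD_integral_def)
  qed
  then show ?thesis using unique le by blast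
qed

end
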